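(* Let $G$ be a $k$-regular graph on $n$ vertices. If $n$ is odd and $k>2\lfloor n/5\rfloor$, then $G$ contains at least $\frac{1}{300}n^2$ triangles.
   Context: Graphs are finite and simple; a triangle is a copy of $K_3$ as a subgraph. *)

theory Defs
  imports Complex_Main "Graph_Theory.Graph_Theory"
begin

text \<open>
  A finite simple graph is a \<^const>\<open>pair_graph\<close>: finite, loop-free, with a symmetric set of
  arcs that are pairs of vertices. An undirected edge is a pair of opposite arcs, so the degree
  of a vertex is its out-degree.
\<close>

definition regular_graph :: "nat \<Rightarrow> 'a pair_pre_digraph \<Rightarrow> bool" where
  "regular_graph k G \<longleftrightarrow> pair_graph G \<and> (\<forall>v \<in> pverts G. out_degree (with_proj G) v = k)"

text \<open>Subgraphs are counted as subgraphs, not up to isomorphism and not as embeddings.\<close>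

definition triangles :: "'a pair_pre_digraph \<Rightarrow> 'a pair_pre_digraph set" where
  "triangles G = {T. subgraph (with_proj T) (with_proj G) \<and> K\<^bsub>3\<^esub> (with_proj T)}"

end

theory Submission
  imports Defs
begin

text \<open>
  By the handshake lemma \<open>k\<close> is even, hence \<open>5k > 2n\<close>. Call an edge heavy if it lies in a
  triangle and light otherwise; if there are fewer than \<open>n\<^sup>2/300\<close> triangles, then fewer than
  \<open>n\<^sup>2/100\<close> edges are heavy. As in the theorem of Andrasfai, \<open>5k > 2n\<close> excludes closed light
  walks of length 5. So for a light edge \<open>ux\<close> whose ends meet few heavy edges, the vertices at light
  distance two from \<open>u\<close> and from \<open>x\<close> form two disjoint sets without inner light edges, and every
  remaining vertex meets many heavy edges. Hence a bipartition \<open>(X, Y)\<close> with the fewest inner edges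
  has fewer than \<open>n\<^sup>2/60\<close> of them. Let \<open>|X| > |Y|\<close>, which is possible as \<open>n\<close> is odd. A vertex
  of \<open>X\<close> with more than \<open>n/10\<close> neighbours in \<open>X\<close> would already lie in \<open>n\<^sup>2/300\<close> triangles, so every
  edge inside \<open>X\<close> has at least \<open>n/10\<close> common neighbours in \<open>Y\<close>, and by regularity there are at
  least \<open>k/2\<close> such edges.
\<close>

section \<open>Counting arcs in a regular symmetric relation\<close>

lemma card_Int_ge:
  assumes "finite Y" "P \<subseteq> Y" "Q \<subseteq> Y"
  shows "card P + card Q \<le> card (P \<inter> Q) + card Y"
  using card_Un_Int[of P Q] card_mono[of Y "P \<union> Q"] assms finite_subset by force

text \<open>The graph as a bare symmetric, irreflexive relation, so that every edge count below is a
  count of ordered pairs.\<close>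

locale regular_adjacency =
  fixes V :: "'a set" and E :: "'a \<Rightarrow> 'a \<Rightarrow> bool" and k :: nat
  assumes finite_V: "finite V"
    and adj_in_V: "E u v \<Longrightarrow> u \<in> V"
    and adj_sym: "E u v \<Longrightarrow> E v u"
    and adj_irrefl: "\<not> E v v"
    and degree: "v \<in> V \<Longrightarrow> card {w. E v w} = k"
begin

abbreviation nb :: "'a \<Rightarrow> 'a set" where "nb v \<equiv> {w. E v w}"

text \<open>Arcs are ordered pairs: an edge with both ends in \<open>P\<close> counts twice in
  \<open>arcs_between P P\<close>.\<close>

definition arcs_between :: "'a set \<Rightarrow> 'a set \<Rightarrow> ('a \<times> 'a) set" where
  "arcs_between P Q = {(a, b). a \<in> P \<and> b \<in> Q \<and> E a b}"

text \<open>Every triangle appears six times, so \<open>n^2/300\<close> triangles amount to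
  \<open>n^2/50\<close> triples.\<close>

definition ordered_triangles :: "('a \<times> 'a \<times> 'a) set" where
  "ordered_triangles = {(a, b, c). E a b \<and> E b c \<and> E a c}"

definition heavy :: "'a \<Rightarrow> 'a \<Rightarrow> bool" where
  "heavy a b \<longleftrightarrow> E a b \<and> (\<exists>c. E a c \<and> E b c)"

definition light :: "'a \<Rightarrow> 'a \<Rightarrow> bool" where
  "light a b \<longleftrightarrow> E a b \<and> \<not> (\<exists>c. E a c \<and> E b c)"

text \<open>Twice the number of edges that do not cross the cut \<open>(X, V - X)\<close>.\<close>

definition inner_arcs :: "'a set \<Rightarrow> nat" where
  "inner_arcs X = card (arcs_between X X) + card (arcs_between (V - X) (V - X))"

lemma nb_subset: "nb v \<subseteq> V"
  using adj_in_V adj_sym by blast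

lemma finite_nb [simp]: "finite (nb v)"
  using finite_subset[OF nb_subset finite_V] .

lemma arcs_between_subset: "arcs_between P Q \<subseteq> V \<times> V"
  unfolding arcs_between_def using adj_in_V adj_sym by blast

lemma finite_arcs_between [simp]: "finite (arcs_between P Q)"
  using finite_subset[OF arcs_between_subset] finite_V by blast

lemma finite_ordered_triangles [simp]: "finite ordered_triangles"
proof (rule finite_subset)
  show "ordered_triangles \<subseteq> V \<times> V \<times> V"
    unfolding ordered_triangles_def using adj_in_V adj_sym by blast
qed (use finite_V in blast)

lemma card_arcs_between:
  assumes "finite P"
  shows "card (arcs_between P Q) = (\<Sum>a\<in>P. card (nb a \<inter> Q))"
proof -
  have "arcs_between P Q = Sigma P (\<lambda>a. nb a \<inter> Q)"
    unfolding arcs_between_def by auto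
  then show ?thesis using assms by simp
qed

lemma card_arcs_between_commute: "card (arcs_between P Q) = card (arcs_between Q P)"
proof -
  have "arcs_between Q P = prod.swap ` arcs_between P Q"
    unfolding arcs_between_def using adj_sym by force
  then show ?thesis by (simp add: card_image)
qed

lemma card_nb_split:
  assumes "X \<subseteq> V" "v \<in> V"
  shows "card (nb v \<inter> X) + card (nb v \<inter> (V - X)) = k"
proof -
  have "card (nb v \<inter> X \<union> nb v \<inter> (V - X)) = card (nb v \<inter> X) + card (nb v \<inter> (V - X))"
    by (rule card_Un_disjoint) auto
  moreover have "nb v \<inter> X \<union> nb v \<inter> (V - X) = nb v"
    using nb_subset by blast
  ultimately show ?thesis using degree[OF assms(2)] by simp
qed

lemma card_arcs_between_insert:
  assumes "finite P" "w \<notin> P"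
  shows "card (arcs_between (insert w P) (insert w P)) = card (arcs_between P P) + 2 * card (nb w \<inter> P)"
proof -
  have dec: "arcs_between (insert w P) (insert w P) = arcs_between P P \<union> (arcs_between {w} P \<union> arcs_between P {w})"
    unfolding arcs_between_def using adj_irrefl by auto
  have "card (arcs_between {w} P \<union> arcs_between P {w}) = card (arcs_between {w} P) + card (arcs_between P {w})"
    by (intro card_Un_disjoint finite_UnI finite_arcs_between) (use assms in \<open>auto simp: arcs_between_def\<close>)
  also have "\<dots> = 2 * card (nb w \<inter> P)"
    using card_arcs_between_commute[of P "{w}"] card_arcs_between[of "{w}" P] by simp
  finally have "card (arcs_between {w} P \<union> arcs_between P {w}) = 2 * card (nb w \<inter> P)" .
  moreover have "card (arcs_between (insert w P) (insert w P))
      = card (arcs_between P P) + card (arcs_between {w} P \<union> arcs_between P {w})"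
    unfolding dec by (intro card_Un_disjoint finite_UnI finite_arcs_between) (use assms in \<open>auto simp: arcs_between_def\<close>)
  ultimately show ?thesis by simp
qed

lemma even_card_arcs_between:
  assumes "finite P"
  shows "even (card (arcs_between P P))"
  using assms
proof (induction P rule: finite_induct)
  case empty
  then show ?case by (simp add: arcs_between_def)
next
  case (insert w P)
  then show ?case using card_arcs_between_insert by simp
qed

lemma handshake: "even (card V * k)"
proof -
  have "card (arcs_between V V) = card V * k"
    using card_arcs_between[OF finite_V] degree nb_subset
    by (simp add: Int_absorb2)
  then show ?thesis using even_card_arcs_between[OF finite_V] by simp
qed

section \<open>Cuts with few inner arcs\<close>

lemma inner_arcs_compl: "X \<subseteq> V \<Longrightarrow> inner_arcs (V - X) = inner_arcs X"
  by (simp add: inner_arcs_def double_diff)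

text \<open>Moving \<open>w\<close> across the cut removes \<open>2 * card (nb w \<inter> X)\<close>
  inner arcs and creates \<open>2 * card (nb w \<inter> (V - X))\<close>. If this is no gain, at
  least half of the neighbours of \<open>w\<close> lie across.\<close>

lemma locally_min_cut:
  assumes "X \<subseteq> V" "w \<in> X" "inner_arcs X \<le> inner_arcs (X - {w})"
  shows "2 * card (nb w \<inter> X) \<le> k"
proof -
  have fX: "finite X" using assms finite_V finite_subset by blast
  have "card (arcs_between X X) = card (arcs_between (X - {w}) (X - {w})) + 2 * card (nb w \<inter> (X - {w}))"
    using card_arcs_between_insert[of "X - {w}" w] fX assms(2) by (simp add: insert_absorb)
  moreover have "nb w \<inter> (X - {w}) = nb w \<inter> X" using adj_irrefl by auto
  moreover have "V - (X - {w}) = insert w (V - X)" using assms by auto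
  moreover have "card (arcs_between (insert w (V - X)) (insert w (V - X)))
      = card (arcs_between (V - X) (V - X)) + 2 * card (nb w \<inter> (V - X))"
    using card_arcs_between_insert[of "V - X" w] finite_V assms by simp
  ultimately have "card (nb w \<inter> X) \<le> card (nb w \<inter> (V - X))"
    using assms(3) unfolding inner_arcs_def by simp
  then show ?thesis using card_nb_split[OF assms(1), of w] assms by force
qed

text \<open>An optimal cut with \<open>A\<close> and \<open>B\<close> pinned to opposite sides; only
  the vertices outside \<open>A\<close> and \<open>B\<close> may be moved, so only they are locally
  optimal. With both sets empty this is a global minimum.\<close>

lemma min_cut_separating:
  assumes "A \<subseteq> V" "A \<inter> B = {}"
  obtains X where "A \<subseteq> X" "X \<subseteq> V" "X \<inter> B = {}"
    "\<And>w. w \<in> X - A \<Longrightarrow> 2 * card (nb w \<inter> X) \<le> k"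
    "\<And>w. w \<in> V - X - B \<Longrightarrow> 2 * card (nb w \<inter> (V - X)) \<le> k"
    "\<And>X'. A \<subseteq> X' \<Longrightarrow> X' \<subseteq> V \<Longrightarrow> X' \<inter> B = {} \<Longrightarrow> inner_arcs X \<le> inner_arcs X'"
proof -
  define ok where "ok X \<longleftrightarrow> A \<subseteq> X \<and> X \<subseteq> V \<and> X \<inter> B = {}" for X
  have "ok A" using assms by (simp add: ok_def)
  then obtain X where X: "ok X" and least: "\<And>X'. ok X' \<Longrightarrow> inner_arcs X \<le> inner_arcs X'"
    using ex_has_least_nat[of ok A inner_arcs] by blast
  show thesis
  proof (rule that)
    show "A \<subseteq> X" "X \<subseteq> V" "X \<inter> B = {}" using X by (auto simp: ok_def)
    show "inner_arcs X \<le> inner_arcs X'" if "A \<subseteq> X'" "X' \<subseteq> V" "X' \<inter> B = {}" for X'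
      using that least by (simp add: ok_def)
    show "2 * card (nb w \<inter> X) \<le> k" if "w \<in> X - A" for w
    proof (rule locally_min_cut)
      show "inner_arcs X \<le> inner_arcs (X - {w})"
        by (rule least) (use that X in \<open>auto simp: ok_def\<close>)
    qed (use that X in \<open>auto simp: ok_def\<close>)
    show "2 * card (nb w \<inter> (V - X)) \<le> k" if "w \<in> V - X - B" for w
    \<comment> \<open>Moving \<open>w\<close> into \<open>X\<close> means removing it from
      \<open>V - X\<close>, and \<open>inner_arcs\<close> is symmetric in the two sides.\<close>
    proof (rule locally_min_cut)
      have "inner_arcs X \<le> inner_arcs (insert w X)"
        by (rule least) (use that X in \<open>auto simp: ok_def\<close>)
      moreover have "V - X - {w} = V - insert w X" by auto
      ultimately show "inner_arcs (V - X) \<le> inner_arcs (V - X - {w})"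
        using inner_arcs_compl[of X] inner_arcs_compl[of "insert w X"] that X by (auto simp: ok_def)
    qed (use that in auto)
  qed
qed

section \<open>Heavy and light edges, and the cut around a light edge\<close>

lemma light_sym: "light a b \<Longrightarrow> light b a"
  unfolding light_def using adj_sym by blast

lemma adj_cases: "E a b \<longleftrightarrow> heavy a b \<or> light a b"
  unfolding light_def heavy_def by blast

lemma card_light_heavy:
  assumes "v \<in> V"
  shows "card {w. light v w} + card {w. heavy v w} = k"
proof -
  have "card ({w. light v w} \<union> {w. heavy v w}) = card {w. light v w} + card {w. heavy v w}"
    by (rule card_Un_disjoint)
      (auto simp: light_def heavy_def intro: finite_subset[OF _ finite_nb[of v]])
  moreover have "{w. light v w} \<union> {w. heavy v w} = nb v" using adj_cases by blast
  ultimately show ?thesis using degree[OF assms] by simp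
qed

lemma sum_heavy_degree: "(\<Sum>v\<in>V. card {w. heavy v w}) = card {(a, b). heavy a b}"
proof -
  have "{(a, b). heavy a b} = Sigma V (\<lambda>v. {w. heavy v w})"
    unfolding heavy_def using adj_in_V by auto
  moreover have "finite {w. heavy v w}" for v
    using finite_subset[OF _ finite_nb[of v]] unfolding heavy_def by auto
  ultimately show ?thesis using finite_V by simp
qed

lemma card_heavy_le: "card {(a, b). heavy a b} \<le> card ordered_triangles"
proof -
  have "{(a, b). heavy a b} \<subseteq> (\<lambda>(a, b, c). (a, b)) ` ordered_triangles"
    unfolding heavy_def ordered_triangles_def by force
  then show ?thesis
    using surj_card_le finite_ordered_triangles by blast
qed

text \<open>No vertex is adjacent to two consecutive vertices of a closed light walk, so a vertex sees at
  most two of the five.\<close>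

lemma no_light_5_walk:
  assumes "2 * card V < 5 * k"
    and l: "light a b" "light b c" "light c d" "light d e" "light e a"
  shows False
proof -
  have V: "a \<in> V" "b \<in> V" "c \<in> V" "d \<in> V" "e \<in> V"
    using l adj_in_V unfolding light_def by blast+
  have deg: "(\<Sum>w\<in>V. of_bool (E v w)) = k" if "v \<in> V" for v
  proof -
    have "V \<inter> {w. E v w} = nb v" using nb_subset by blast
    then show ?thesis using degree[OF that] finite_V by simp
  qed
  have "5 * k = (\<Sum>w\<in>V. of_bool (E a w) + of_bool (E b w) + of_bool (E c w) + of_bool (E d w) + of_bool (E e w))"
    using V by (simp add: sum.distrib deg)
  also have "\<dots> \<le> (\<Sum>w\<in>V. 2)"
    by (rule sum_mono) (use l in \<open>auto simp: light_def of_bool_def\<close>)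
  finally show False using assms(1) by simp
qed

text \<open>The last assumption says \<open>3k \<le> 10(3k - n - h(u) - h(x))\<close> for the heavy degree \<open>h\<close>: a vertex
  without light neighbours in the light neighbourhoods of \<open>u\<close> and \<open>x\<close> has at least \<open>3k/10\<close> heavy
  neighbours there.\<close>

lemma cut_from_light_edge:
  assumes k: "2 * card V < 5 * k"
    and ux: "light u x"
    and small: "10 * card V + 10 * card {w. heavy u w} + 10 * card {w. heavy x w} \<le> 27 * k"
  obtains X where "X \<subseteq> V" "3 * inner_arcs X \<le> 5 * card {(a, b). heavy a b}"
proof -
  define A0 B0 where "A0 = {w. light u w}" and "B0 = {w. light x w}"
  \<comment> \<open>\<open>A\<close> is built from \<open>x\<close> and \<open>B\<close> from
    \<open>u\<close>: since \<open>ux\<close> is itself light, the light neighbours of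
    \<open>u\<close> fall into \<open>A\<close> and those of \<open>x\<close> into \<open>B\<close>.
    A common vertex of \<open>A\<close> and \<open>B\<close>, or a light edge inside either, would
    close a light 5-walk.\<close>
  define A B where "A = {w. \<exists>b. light x b \<and> light b w}" and "B = {w. \<exists>a. light u a \<and> light a w}"
  define R where "R = V - A - B"
  define C where "C = A0 \<union> B0"
  have lV: "a \<in> V" "b \<in> V" if "light a b" for a b
    using that adj_in_V light_sym unfolding light_def by blast+
  have sub: "A \<subseteq> V" "B \<subseteq> V" "A0 \<subseteq> A" "B0 \<subseteq> B"
    unfolding A_def B_def A0_def B0_def using lV ux light_sym by blast+
  have AB: "A \<inter> B = {}"
  proof (rule ccontr)
    assume "A \<inter> B \<noteq> {}"
    then obtain w a b where "light x b" "light b w" "light u a" "light a w"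
      unfolding A_def B_def by blast
    then show False using no_light_5_walk[OF k, of w b x u a] ux light_sym by blast
  qed
  have indepA: "\<not> light a a'" if "a \<in> A" "a' \<in> A" for a a'
  proof
    assume "light a a'"
    moreover obtain b b' where "light x b" "light b a" "light x b'" "light b' a'"
      using \<open>a \<in> A\<close> \<open>a' \<in> A\<close> unfolding A_def by blast
    ultimately show False using no_light_5_walk[OF k, of a b x b' a'] light_sym by blast
  qed
  have indepB: "\<not> light a a'" if "a \<in> B" "a' \<in> B" for a a'
  proof
    assume "light a a'"
    moreover obtain b b' where "light u b" "light b a" "light u b'" "light b' a'"
      using \<open>a \<in> B\<close> \<open>a' \<in> B\<close> unfolding B_def by blast
    ultimately show False using no_light_5_walk[OF k, of a b u b' a'] light_sym by blast
  qed
  \<comment> \<open>A light neighbour of a vertex of \<open>A0\<close> is in \<open>B\<close>, and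
    one of a vertex of \<open>B0\<close> is in \<open>A\<close>.\<close>
  have RC: "\<not> light w c" "\<not> light c w" if "w \<in> R" "c \<in> C" for w c
    using that light_sym unfolding R_def C_def A_def B_def A0_def B0_def by blast+
  have fin: "finite R" "finite A0" "finite B0" "finite A" "finite B" "finite C"
    using finite_subset[OF sub(1) finite_V] finite_subset[OF sub(2) finite_V] finite_V sub(3,4)
    by (auto simp: R_def C_def intro: finite_subset)
  have CV: "C \<subseteq> V" using sub unfolding C_def by blast
  have cardC: "card C = card A0 + card B0"
    unfolding C_def using AB sub fin by (intro card_Un_disjoint) auto
  \<comment> \<open>At most \<open>card V - card C\<close> neighbours of \<open>w\<close> miss
    \<open>C\<close>, and \<open>card C\<close> is \<open>2k - h(u) - h(x)\<close>.\<close>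
  have degR: "3 * k \<le> 10 * card (nb w \<inter> C)" if "w \<in> R" for w
  proof -
    have "w \<in> V" using that by (simp add: R_def)
    then have "k = card (nb w \<inter> C) + card (nb w \<inter> (V - C))" using card_nb_split[OF CV] by simp
    moreover have "card (nb w \<inter> (V - C)) \<le> card (V - C)"
      using finite_V by (intro card_mono) auto
    moreover have "card (V - C) + card C = card V"
      using card_Diff_subset[OF fin(6) CV] card_mono[OF finite_V CV] by simp
    moreover have "card A0 + card {w. heavy u w} = k" "card B0 + card {w. heavy x w} = k"
      unfolding A0_def B0_def using card_light_heavy lV[OF ux] by auto
    ultimately show ?thesis using small cardC by linarith
  qed
  have arcsRC: "3 * (k * card R) \<le> 10 * card (arcs_between R C)"
  proof -
    have "3 * (k * card R) = (\<Sum>w\<in>R. 3 * k)" by simp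
    also have "\<dots> \<le> (\<Sum>w\<in>R. 10 * card (nb w \<inter> C))" by (rule sum_mono) (rule degR)
    also have "\<dots> = 10 * card (arcs_between R C)"
      using card_arcs_between[OF fin(1)] by (simp add: sum_distrib_left)
    finally show ?thesis .
  qed
  \<comment> \<open>All arcs inside \<open>A\<close>, inside \<open>B\<close>, and between
    \<open>R\<close> and \<open>C\<close> are heavy; the last kind occurs in both directions, hence
    the factor 2.\<close>
  have heavy_count: "card (arcs_between A A) + card (arcs_between B B) + 2 * card (arcs_between R C)
      \<le> card {(a, b). heavy a b}"
  proof -
    have "card (arcs_between R C \<union> arcs_between C R) = card (arcs_between R C) + card (arcs_between C R)"
      by (intro card_Un_disjoint finite_UnI finite_arcs_between) (use sub in \<open>auto simp: arcs_between_def R_def C_def\<close>)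
    moreover have "card (arcs_between A A \<union> arcs_between B B) = card (arcs_between A A) + card (arcs_between B B)"
      by (intro card_Un_disjoint finite_UnI finite_arcs_between) (use AB in \<open>auto simp: arcs_between_def\<close>)
    moreover have "card ((arcs_between A A \<union> arcs_between B B) \<union> (arcs_between R C \<union> arcs_between C R))
        = card (arcs_between A A \<union> arcs_between B B) + card (arcs_between R C \<union> arcs_between C R)"
      by (intro card_Un_disjoint finite_UnI finite_arcs_between) (auto simp: arcs_between_def R_def)
    moreover have "card ((arcs_between A A \<union> arcs_between B B) \<union> (arcs_between R C \<union> arcs_between C R))
        \<le> card {(a, b). heavy a b}"
    proof (rule card_mono)
      show "finite {(a, b). heavy a b}"
        by (rule finite_subset[OF _ finite_arcs_between[of V V]])
          (use adj_in_V adj_sym in \<open>auto simp: heavy_def arcs_between_def\<close>)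
      show "(arcs_between A A \<union> arcs_between B B) \<union> (arcs_between R C \<union> arcs_between C R)
          \<subseteq> {(a, b). heavy a b}"
        using indepA indepB RC adj_cases unfolding arcs_between_def by auto
    qed
    ultimately show ?thesis using card_arcs_between_commute[of C R] by linarith
  qed
  \<comment> \<open>Only vertices of \<open>R\<close> are free to move, so each of them has at most
    \<open>k/2\<close> neighbours on its own side.\<close>
  obtain X where X: "A \<subseteq> X" "X \<subseteq> V" "X \<inter> B = {}"
    "\<And>w. w \<in> X - A \<Longrightarrow> 2 * card (nb w \<inter> X) \<le> k"
    "\<And>w. w \<in> V - X - B \<Longrightarrow> 2 * card (nb w \<inter> (V - X)) \<le> k"
    using min_cut_separating[OF sub(1) AB] by metis
  define own where "own w = nb w \<inter> (if w \<in> X then X else V - X)" for w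
  \<comment> \<open>\<open>S\<close> and its reversal cover every inner arc with an end in
    \<open>R\<close>; the other inner arcs lie inside \<open>A\<close> or inside
    \<open>B\<close>.\<close>
  define S where "S = Sigma R own"
  have own: "2 * card (own w) \<le> k" if "w \<in> R" for w
    using that X(4)[of w] X(5)[of w] unfolding own_def R_def by auto
  have "finite (own w)" for w unfolding own_def by simp
  then have finS: "finite S" and "card S = (\<Sum>w\<in>R. card (own w))"
    unfolding S_def using fin by auto
  then have "2 * card S \<le> (\<Sum>w\<in>R. k)"
    using own by (simp add: sum_distrib_left sum_mono del: sum_constant)
  then have cardS: "2 * card S \<le> k * card R" by (simp add: mult.commute)
  have "inner_arcs X = card (arcs_between X X \<union> arcs_between (V - X) (V - X))"
    unfolding inner_arcs_def
    by (rule card_Un_disjoint[OF finite_arcs_between finite_arcs_between, symmetric])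
      (auto simp: arcs_between_def)
  also have "\<dots> \<le> card ((arcs_between A A \<union> arcs_between B B) \<union> (S \<union> prod.swap ` S))"
  proof (rule card_mono)
    show "finite ((arcs_between A A \<union> arcs_between B B) \<union> (S \<union> prod.swap ` S))"
      using finS by simp
    show "arcs_between X X \<union> arcs_between (V - X) (V - X)
        \<subseteq> (arcs_between A A \<union> arcs_between B B) \<union> (S \<union> prod.swap ` S)"
    proof (rule subrelI)
      fix a b assume ab: "(a, b) \<in> arcs_between X X \<union> arcs_between (V - X) (V - X)"
      show "(a, b) \<in> (arcs_between A A \<union> arcs_between B B) \<union> (S \<union> prod.swap ` S)"
      proof (cases "a \<in> R \<or> b \<in> R")
        case True
        then have "(a, b) \<in> S \<or> (b, a) \<in> S"
          using ab adj_sym unfolding S_def own_def arcs_between_def by auto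
        then show ?thesis by force
      next
        case False
        then show ?thesis using ab X(1-3) unfolding R_def arcs_between_def by blast
      qed
    qed
  qed
  also have "\<dots> \<le> card (arcs_between A A) + card (arcs_between B B) + (card S + card (prod.swap ` S))"
    by (intro order_trans[OF card_Un_le] add_mono card_Un_le)
  also have "card (prod.swap ` S) = card S" by (simp add: card_image)
  \<comment> \<open>Here \<open>2 * card S \<le> k * card R\<close>, which is at most 10/3 of the
    arcs from \<open>R\<close> to \<open>C\<close>, that is 5/3 of the heavy arcs between
    \<open>R\<close> and \<open>C\<close> in both directions. Arcs inside \<open>A\<close> and
    \<open>B\<close> enter with factor 1, so 5/3 covers everything.\<close>
  finally have "3 * inner_arcs X \<le> 5 * card {(a, b). heavy a b}"
    using heavy_count arcsRC cardS by linarith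
  then show thesis using that X(2) by blast
qed

section \<open>Triangle counts relative to a vertex set \<open>X\<close>\<close>

lemma ordered_triangles_at_vertex:
  "3 * card {(b, c). E v b \<and> E v c \<and> E b c} \<le> card ordered_triangles"
proof -
  let ?S = "{(b, c). E v b \<and> E v c \<and> E b c}"
  \<comment> \<open>\<open>v\<close> can stand in any of the three places of a triple, and the three
    images are disjoint because \<open>E\<close> is irreflexive.\<close>
  let ?f = "\<lambda>(b, c). (v, b, c)" and ?g = "\<lambda>(b, c). (b, v, c)" and ?h = "\<lambda>(b, c). (b, c, v)"
  have fin: "finite ?S"
    by (rule finite_subset[of _ "nb v \<times> nb v"]) auto
  have "card (?f ` ?S) = card ?S" "card (?g ` ?S) = card ?S" "card (?h ` ?S) = card ?S"
    by (rule card_image; auto simp: inj_on_def)+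
  moreover have "card (?f ` ?S \<union> ?g ` ?S) = card (?f ` ?S) + card (?g ` ?S)"
    by (rule card_Un_disjoint) (use fin adj_irrefl in auto)
  moreover have "card (?f ` ?S \<union> ?g ` ?S \<union> ?h ` ?S) = card (?f ` ?S \<union> ?g ` ?S) + card (?h ` ?S)"
    by (rule card_Un_disjoint) (use fin adj_irrefl in auto)
  moreover have "card (?f ` ?S \<union> ?g ` ?S \<union> ?h ` ?S) \<le> card ordered_triangles"
    by (rule card_mono[OF finite_ordered_triangles])
      (use adj_sym in \<open>auto simp: ordered_triangles_def\<close>)
  ultimately show ?thesis by linarith
qed

text \<open>Split the neighbours of \<open>v\<close> into \<open>P\<close> inside \<open>X\<close>
  and \<open>Q\<close> outside. A vertex \<open>a\<close> of \<open>P\<close> with few neighbours in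
  \<open>X\<close> has many in \<open>V - X\<close>, where they must overlap \<open>Q\<close>; each
  such overlap is a triangle at \<open>v\<close>. Summing over \<open>P\<close> gives the
  bound.\<close>

lemma inner_degree_bound:
  assumes X: "X \<subseteq> V" and v: "v \<in> X"
  defines "p \<equiv> card (nb v \<inter> X)"
  shows "12 * (p * k) \<le> card ordered_triangles + 3 * card (arcs_between X X)
    + 6 * (p * (p + card (V - X)))"
proof -
  define P Q where "P = nb v \<inter> X" and "Q = nb v \<inter> (V - X)"
  have fin: "finite P" "finite Q" by (simp_all add: P_def Q_def)
  have cardP: "card P = p" by (simp add: P_def p_def)
  have degv: "p + card Q = k"
    unfolding p_def Q_def using card_nb_split[OF X] v X by blast
  have *: "2 * k \<le> card (nb a \<inter> Q) + card (nb a \<inter> X) + (p + card (V - X))" if "a \<in> P" for a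
  proof -
    have "a \<in> V" using that X unfolding P_def by blast
    then have "card (nb a \<inter> X) + card (nb a \<inter> (V - X)) = k" using card_nb_split[OF X] by blast
    moreover have "card (nb a \<inter> (V - X)) + card Q \<le> card ((nb a \<inter> (V - X)) \<inter> Q) + card (V - X)"
      by (rule card_Int_ge) (use finite_V in \<open>auto simp: Q_def\<close>)
    moreover have "(nb a \<inter> (V - X)) \<inter> Q = nb a \<inter> Q" by (auto simp: Q_def)
    ultimately show ?thesis using degv by simp
  qed
  have "p * (2 * k) = (\<Sum>a\<in>P. 2 * k)" by (simp add: cardP)
  also have "\<dots> \<le> (\<Sum>a\<in>P. card (nb a \<inter> Q) + card (nb a \<inter> X) + (p + card (V - X)))"
    by (rule sum_mono) (rule *)
  also have "\<dots> = card (arcs_between P Q) + card (arcs_between P X) + p * (p + card (V - X))"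
    by (simp add: sum.distrib card_arcs_between[OF fin(1)] cardP)
  finally have lower: "2 * (p * k) \<le> card (arcs_between P Q) + card (arcs_between P X) + p * (p + card (V - X))"
    by (simp add: algebra_simps)
  \<comment> \<open>The arcs from \<open>P\<close> to \<open>X\<close> and their reversals overlap
    exactly in the arcs inside \<open>P\<close>. That overlap is paid for below, since arcs inside
    \<open>P\<close> also span triangles with \<open>v\<close>.\<close>
  have PX: "2 * card (arcs_between P X) \<le> card (arcs_between X X) + card (arcs_between P P)"
  proof -
    have "card (arcs_between P X) + card (arcs_between X P)
        = card (arcs_between P X \<union> arcs_between X P) + card (arcs_between P X \<inter> arcs_between X P)"
      by (rule card_Un_Int) auto
    moreover have "arcs_between P X \<inter> arcs_between X P = arcs_between P P"
      unfolding arcs_between_def P_def by auto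
    moreover have "card (arcs_between P X \<union> arcs_between X P) \<le> card (arcs_between X X)"
      by (intro card_mono finite_arcs_between) (auto simp: arcs_between_def P_def)
    ultimately show ?thesis using card_arcs_between_commute[of X P] by simp
  qed
  have "card (arcs_between P Q \<union> arcs_between Q P) = card (arcs_between P Q) + card (arcs_between Q P)"
    by (intro card_Un_disjoint finite_UnI finite_arcs_between) (auto simp: arcs_between_def P_def Q_def)
  moreover have "card (arcs_between P Q \<union> arcs_between Q P \<union> arcs_between P P)
      = card (arcs_between P Q \<union> arcs_between Q P) + card (arcs_between P P)"
    by (intro card_Un_disjoint finite_UnI finite_arcs_between) (auto simp: arcs_between_def P_def Q_def)
  moreover have "card (arcs_between P Q \<union> arcs_between Q P \<union> arcs_between P P)
      \<le> card {(b, c). E v b \<and> E v c \<and> E b c}"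
  proof (rule card_mono)
    show "finite {(b, c). E v b \<and> E v c \<and> E b c}"
      by (rule finite_subset[of _ "nb v \<times> nb v"]) auto
  qed (auto simp: arcs_between_def P_def Q_def)
  ultimately have "6 * card (arcs_between P Q) + 3 * card (arcs_between P P) \<le> card ordered_triangles"
    using ordered_triangles_at_vertex[of v] card_arcs_between_commute[of Q P] by linarith
  then show ?thesis using lower PX by linarith
qed

text \<open>Each end of an arc inside \<open>X\<close> has at least \<open>k - d\<close> neighbours
  in \<open>V - X\<close>, so the two ends share at least \<open>m\<close> there. Each shared one
  completes a different ordered triangle.\<close>

lemma inner_arcs_many_triangles:
  assumes X: "X \<subseteq> V" and d: "\<And>a. a \<in> X \<Longrightarrow> card (nb a \<inter> X) \<le> d"
    and m: "m + 2 * d + card (V - X) \<le> 2 * k"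
  shows "m * card (arcs_between X X) \<le> card ordered_triangles"
proof -
  define F where "F = (\<lambda>(a, b). nb a \<inter> nb b \<inter> (V - X))"
  have F: "m \<le> card (F e)" if e: "e \<in> arcs_between X X" for e
  proof -
    obtain a b where ab: "e = (a, b)" "a \<in> X" "b \<in> X" using e unfolding arcs_between_def by blast
    have "card (nb a \<inter> (V - X)) + card (nb b \<inter> (V - X))
        \<le> card ((nb a \<inter> (V - X)) \<inter> (nb b \<inter> (V - X))) + card (V - X)"
      by (rule card_Int_ge) (use finite_V in auto)
    moreover have "(nb a \<inter> (V - X)) \<inter> (nb b \<inter> (V - X)) = F e" by (auto simp: F_def ab)
    then have "card ((nb a \<inter> (V - X)) \<inter> (nb b \<inter> (V - X))) = card (F e)" by (rule arg_cong)
    moreover have "card (nb a \<inter> X) + card (nb a \<inter> (V - X)) = k"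
      "card (nb b \<inter> X) + card (nb b \<inter> (V - X)) = k"
      using card_nb_split[OF X] ab X by blast+
    ultimately show ?thesis using d[OF ab(2)] d[OF ab(3)] m by linarith
  qed
  have finF: "finite (F e)" for e by (cases e) (simp add: F_def)
  have "m * card (arcs_between X X) = (\<Sum>e\<in>arcs_between X X. m)" by simp
  also have "\<dots> \<le> (\<Sum>e\<in>arcs_between X X. card (F e))" by (rule sum_mono) (rule F)
  also have "\<dots> = card (Sigma (arcs_between X X) F)" using finF by simp
  also have "\<dots> = card ((\<lambda>((a, b), c). (a, b, c)) ` Sigma (arcs_between X X) F)"
    by (rule card_image[symmetric]) (auto simp: inj_on_def)
  also have "\<dots> \<le> card ordered_triangles"
    by (rule card_mono[OF finite_ordered_triangles])
      (auto simp: F_def arcs_between_def ordered_triangles_def)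
  finally show ?thesis .
qed

text \<open>Both sides send equally many arcs across, so by regularity the surplus
  \<open>k * (card X - card (V - X))\<close> must stay inside \<open>X\<close>.\<close>

lemma arcs_in_larger_side:
  assumes X: "X \<subseteq> V" and "card (V - X) < card X"
  shows "k \<le> card (arcs_between X X)"
proof -
  have fX: "finite X" "finite (V - X)" using X finite_V finite_subset by blast+
  have count: "card (arcs_between P X) + card (arcs_between P (V - X)) = card P * k"
    if "P \<subseteq> V" "finite P" for P
  proof -
    have "card (arcs_between P X) + card (arcs_between P (V - X))
        = (\<Sum>a\<in>P. card (nb a \<inter> X) + card (nb a \<inter> (V - X)))"
      using that by (simp add: card_arcs_between sum.distrib)
    also have "\<dots> = (\<Sum>a\<in>P. k)"
      by (rule sum.cong) (use that card_nb_split[OF X] in auto)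
    finally show ?thesis by simp
  qed
  have "card (arcs_between (V - X) X) \<le> card (V - X) * k"
    using count[of "V - X"] fX by simp
  moreover have "card X * k \<ge> (card (V - X) + 1) * k"
    using assms(2) by (intro mult_right_mono) auto
  ultimately show ?thesis
    using count[OF X fX(1)] card_arcs_between_commute[of X "V - X"] by (simp add: algebra_simps)
qed

section \<open>Choice of the light edge and the contradiction\<close>

lemma light_edge_small_heavy_degree:
  assumes k: "2 * card V < 5 * k" and few: "50 * card ordered_triangles < (card V)\<^sup>2"
  obtains u x where "light u x"
    "10 * card V + 10 * card {w. heavy u w} + 10 * card {w. heavy x w} \<le> 27 * k"
proof -
  define n where "n = card V"
  define h where "h v = card {w. heavy v w}" for v
  have hsum: "50 * (\<Sum>v\<in>V. h v) < n * n"
    using few card_heavy_le sum_heavy_degree unfolding h_def n_def power2_eq_square by linarith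
  have n0: "n > 0" using hsum by (cases n) auto
  have "\<exists>u\<in>V. 50 * h u < n"
  proof (rule ccontr)
    assume "\<not> ?thesis"
    then have "(\<Sum>v\<in>V. n) \<le> (\<Sum>v\<in>V. 50 * h v)" by (intro sum_mono) auto
    then show False using hsum by (simp add: n_def sum_distrib_left)
  qed
  then obtain u where u: "u \<in> V" "50 * h u < n" by blast
  \<comment> \<open>The threshold is exact:
    \<open>10n + 10(n/50) + 10(3n/50) = 27(2n/5)\<close>.\<close>
  define M where "M = {v \<in> V. 3 * n < 50 * h v}"
  have fM: "finite M" using finite_V by (simp add: M_def)
  have "card M * (3 * n) = (\<Sum>v\<in>M. 3 * n)" by simp
  also have "\<dots> \<le> (\<Sum>v\<in>M. 50 * h v)" by (rule sum_mono) (simp add: M_def)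
  also have "\<dots> \<le> (\<Sum>v\<in>V. 50 * h v)"
    by (rule sum_mono2) (use finite_V in \<open>auto simp: M_def\<close>)
  also have "\<dots> < n * n" using hsum by (simp add: sum_distrib_left)
  finally have "(3 * card M) * n < n * n" by (simp add: algebra_simps)
  then have cM: "3 * card M < n" using n0 by simp
  have "card {w. light u w} + h u = k" using card_light_heavy[OF u(1)] by (simp add: h_def)
  \<comment> \<open>\<open>u\<close> has more than \<open>2n/5 - n/50 = 19n/50\<close> light
    neighbours, while \<open>M\<close> has fewer than \<open>n/3\<close> vertices.\<close>
  then have "card M < card {w. light u w}" using cM u(2) k unfolding n_def[symmetric] by linarith
  then have "\<not> {w. light u w} \<subseteq> M" using card_mono[OF fM, of "{w. light u w}"] by linarith
  then obtain x where x: "light u x" "x \<notin> M" by blast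
  then have "x \<in> V" using light_sym adj_in_V unfolding light_def by blast
  then have "50 * h x \<le> 3 * n" using x unfolding M_def by auto
  then have "10 * card V + 10 * h u + 10 * h x \<le> 27 * k"
    using u(2) k unfolding n_def[symmetric] by linarith
  then show thesis using that x(1) unfolding h_def by blast
qed

theorem many_ordered_triangles:
  assumes k: "2 * card V < 5 * k" and odd: "odd (card V)"
  shows "(card V)\<^sup>2 \<le> 50 * card ordered_triangles"
proof (rule ccontr)
  assume "\<not> ?thesis"
  then have few: "50 * card ordered_triangles < (card V)\<^sup>2" by simp
  define n where "n = card V"
  obtain u x where "light u x"
    "10 * card V + 10 * card {w. heavy u w} + 10 * card {w. heavy x w} \<le> 27 * k"
    using light_edge_small_heavy_degree[OF k few] by blast
  then obtain X1 where X1: "X1 \<subseteq> V" "3 * inner_arcs X1 \<le> 5 * card {(a, b). heavy a b}"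
    using cut_from_light_edge[OF k] by metis
  obtain X0 where X0: "X0 \<subseteq> V"
    "\<And>w. w \<in> X0 \<Longrightarrow> 2 * card (nb w \<inter> X0) \<le> k"
    "\<And>w. w \<in> V - X0 \<Longrightarrow> 2 * card (nb w \<inter> (V - X0)) \<le> k"
    "\<And>X'. X' \<subseteq> V \<Longrightarrow> inner_arcs X0 \<le> inner_arcs X'"
    using min_cut_separating[of "{}" "{}"] by auto
  \<comment> \<open>There are fewer than \<open>n^2/50\<close> heavy arcs, and 5/3 of this is
    \<open>n^2/30\<close>.\<close>
  have inner0: "30 * inner_arcs X0 < n\<^sup>2"
    using X0(4)[OF X1(1)] X1(2) few card_heavy_le unfolding n_def by linarith
  have split: "card X0 + card (V - X0) = n"
    using card_Diff_subset[of X0 V] card_mono[OF finite_V X0(1)] finite_subset[OF X0(1) finite_V] X0(1)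
    unfolding n_def by simp
  \<comment> \<open>Oddness rules out a balanced cut. Taking the larger side as \<open>X\<close>
    keeps all minimality properties, since these are symmetric in the two sides.\<close>
  then have "card X0 \<noteq> card (V - X0)" using odd unfolding n_def by presburger
  then obtain X where X: "X \<subseteq> V" "card (V - X) < card X" "card X + card (V - X) = n"
    "\<And>w. w \<in> X \<Longrightarrow> 2 * card (nb w \<inter> X) \<le> k" "30 * inner_arcs X < n\<^sup>2"
  proof (cases "card (V - X0) < card X0")
    case True
    then show thesis using that[of X0] X0 inner0 split by blast
  next
    case False
    then have "card (V - (V - X0)) < card (V - X0)"
      using \<open>card X0 \<noteq> card (V - X0)\<close> X0(1) by (simp add: double_diff)
    then show thesis
      using that[of "V - X0"] X0 inner0 split inner_arcs_compl[OF X0(1)] by (simp add: double_diff)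
  qed
  define y where "y = card (V - X)"
  have y: "2 * y < n" using X(2,3) unfolding y_def by linarith
  have eX: "30 * card (arcs_between X X) < n\<^sup>2"
  proof -
    have "card (arcs_between X X) \<le> inner_arcs X" by (simp add: inner_arcs_def)
    then show ?thesis using X(5) by linarith
  qed
  have p: "10 * card (nb v \<inter> X) \<le> n" if v: "v \<in> X" for v
  proof (rule ccontr)
    define p where "p = card (nb v \<inter> X)"
    assume "\<not> ?thesis"
    then have p1: "10 * p > n" by (simp add: p_def)
    have p2: "2 * p \<le> k" using X(4)[OF v] by (simp add: p_def)
    have "12 * (p * k) \<le> card ordered_triangles + 3 * card (arcs_between X X) + 6 * (p * (p + y))"
      using inner_degree_bound[OF X(1) v] unfolding p_def y_def .
    then have "600 * (p * k) < 6 * n\<^sup>2 + 300 * (p * (p + y))"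
      using few eX unfolding n_def[symmetric] by linarith
    moreover have "2 * (p * (p + y)) \<le> p * (2 * p + n)"
      using y by (simp add: algebra_simps flip: distrib_left)
    ultimately have "600 * (p * k) < 6 * n\<^sup>2 + 150 * (p * (2 * p + n))" by linarith
    then have "real (600 * (p * k)) < real (6 * n\<^sup>2 + 150 * (p * (2 * p + n)))"
      by (simp only: of_nat_less_iff)
    then have main: "100 * (real p * k) < n * n + 50 * (real p * p) + 25 * (real p * n)"
      by (simp add: algebra_simps power2_eq_square)
    show False
    proof (cases "5 * p \<le> n")
      case True
      \<comment> \<open>With \<open>5k > 2n\<close>, \<open>main\<close> would give
        \<open>50p^2 - 15pn + n^2 > 0\<close>. The left side is \<open>-(10p - n)(n - 5p)\<close>,
        hence not positive for \<open>n/10 < p \<le> n/5\<close>.\<close>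
      have "0 \<le> (10 * real p - n) * (n - 5 * real p)"
        using True p1 by (intro mult_nonneg_nonneg) linarith+
      moreover have "real p * (2 * n) \<le> real p * (5 * k)"
        using k unfolding n_def[symmetric] by (intro mult_left_mono) linarith+
      ultimately show ?thesis using main by (simp add: algebra_simps)
    next
      case False
      \<comment> \<open>For \<open>p > n/5\<close> local minimality \<open>k \<ge> 2p\<close> takes
        over: the left side of \<open>main\<close> is at least \<open>200p^2\<close>, the right side
        at most \<open>(25 + 50 + 125)p^2\<close>.\<close>
      have "real p * (2 * real p) \<le> real p * k" using p2 by (intro mult_left_mono) linarith+
      moreover have "real n * n \<le> (5 * real p) * n" using False by (intro mult_right_mono) linarith+
      moreover have "real p * n \<le> real p * (5 * real p)" using False by (intro mult_left_mono) linarith+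
      ultimately show ?thesis using main by (simp add: algebra_simps)
    qed
  qed
  \<comment> \<open>\<open>2k - 2d - y\<close> is at least \<open>4n/5 - n/5 - n/2 = n/10\<close>,
    so the subtraction on naturals does not truncate.\<close>
  define d m where "d = n div 10" and "m = 2 * k - 2 * d - y"
  have dn: "10 * d \<le> n" unfolding d_def by simp
  have m: "m + 2 * d + card (V - X) \<le> 2 * k" "n \<le> 10 * m"
    using dn y k unfolding m_def y_def[symmetric] n_def[symmetric] by linarith+
  have "m * card (arcs_between X X) \<le> card ordered_triangles"
    by (rule inner_arcs_many_triangles[OF X(1) _ m(1)]) (use p in \<open>force simp: d_def\<close>)
  moreover have "m * k \<le> m * card (arcs_between X X)"
    using arcs_in_larger_side[OF X(1,2)] by simp
  \<comment> \<open>Thus \<open>m * k\<close> is at least \<open>(n/10)(2n/5) = n^2/25\<close>,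
    twice the assumed upper bound on ordered triangles.\<close>
  moreover have "n * (2 * n) \<le> (10 * m) * (5 * k)"
    by (rule mult_mono) (use m(2) k in \<open>auto simp: n_def\<close>)
  ultimately have "2 * (n * n) \<le> 50 * card ordered_triangles" by linarith
  then show False using few unfolding n_def[symmetric] power2_eq_square by simp
qed

end


section \<open>From ordered triples to triangle subgraphs\<close>

lemma card_ordered_triples_le:
  assumes "finite F" and "\<And>S. S \<in> F \<Longrightarrow> card S = 3"
  shows "card {(a, b, c). distinct [a, b, c] \<and> {a, b, c} \<in> F} \<le> 6 * card F"
proof -
  define O3 where "O3 S = {(a, b, c). distinct [a, b, c] \<and> {a, b, c} = S}" for S :: "'a set"
  have O3: "finite (O3 S)" "card (O3 S) \<le> 6" if SF: "S \<in> F" for S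
  proof -
    obtain x y z where S: "S = {x, y, z}" "distinct [x, y, z]"
      using assms(2)[OF SF] unfolding card_3_iff by auto
    define L where "L = [(x, y, z), (x, z, y), (y, x, z), (y, z, x), (z, x, y), (z, y, x)]"
    have "O3 S \<subseteq> set L"
    proof
      fix t assume "t \<in> O3 S"
      then obtain a b c where t: "t = (a, b, c)" "distinct [a, b, c]" "{a, b, c} = {x, y, z}"
        unfolding O3_def S(1) by blast
      then have "a \<in> {x, y, z}" "b \<in> {x, y, z}" "c \<in> {x, y, z}" by blast+
      then show "t \<in> set L" using t(1,2) unfolding L_def by auto
    qed
    then show "finite (O3 S)" "card (O3 S) \<le> 6"
      using card_mono[of "set L" "O3 S"] card_length[of L] finite_subset[of "O3 S" "set L"]
      by (auto simp: L_def)
  qed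
  have "{(a, b, c). distinct [a, b, c] \<and> {a, b, c} \<in> F} = (\<Union>S\<in>F. O3 S)"
    unfolding O3_def by auto
  also have "card \<dots> \<le> (\<Sum>S\<in>F. card (O3 S))" by (rule card_UN_le[OF assms(1)])
  also have "\<dots> \<le> (\<Sum>S\<in>F. 6)" by (rule sum_mono) (rule O3)
  finally show ?thesis by (simp add: mult.commute)
qed

text \<open>The vertex sets of triangles form a family \<open>F\<close> of 3-sets. The complete
  digraph \<open>K S\<close> on such a set is a triangle subgraph that determines \<open>S\<close>,
  and each \<open>S\<close> has at most six orderings.\<close>

lemma card_ordered_triangles_le:
  assumes "pair_graph G"
  shows "card {(a, b, c). (a, b) \<in> parcs G \<and> (b, c) \<in> parcs G \<and> (a, c) \<in> parcs G}
    \<le> 6 * card (triangles G)"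
proof -
  interpret pair_graph G by fact
  define F where "F = {{a, b, c} | a b c. (a, b) \<in> parcs G \<and> (b, c) \<in> parcs G \<and> (a, c) \<in> parcs G}"
  have sym: "(b, a) \<in> parcs G" if "(a, b) \<in> parcs G" for a b
    using that pair_sym_arcs unfolding symmetric_def by (auto elim: symE)
  have loop: "a \<noteq> b" if "(a, b) \<in> parcs G" for a b
    using pair_no_loops[OF that] by simp
  have "F \<subseteq> Pow (pverts G)"
    unfolding F_def using in_arcsD1 in_arcsD2 by blast
  then have finF: "finite F" using pair_finite_verts finite_subset by blast
  have card3: "card S = 3" if "S \<in> F" for S
    using that loop unfolding F_def card_3_iff by blast
  have clique: "(u, v) \<in> parcs G" if "S \<in> F" "u \<in> S" "v \<in> S" "u \<noteq> v" for S u v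
    using that sym unfolding F_def by blast
  define K :: "'a set \<Rightarrow> 'a pair_pre_digraph"
    where "K S = \<lparr>pverts = S, parcs = {(u, v). (u, v) \<in> S \<times> S \<and> u \<noteq> v}\<rparr>" for S
  have KT: "K S \<in> triangles G" if "S \<in> F" for S
  proof -
    have comp: "K\<^bsub>3\<^esub> (with_proj (K S))"
      unfolding complete_digraph_pair_def using card3[OF that] card_ge_0_finite[of S]
      by (simp add: K_def)
    have wf: "wf_digraph (with_proj (K S))"
      by unfold_locales (auto simp: K_def)
    have "S \<subseteq> pverts G" using \<open>F \<subseteq> Pow (pverts G)\<close> that by blast
    then have "subgraph (with_proj (K S)) (with_proj G)"
      unfolding subgraph_def compatible_def using wf wf_digraph clique[OF that]
      by (auto simp: K_def)
    then show ?thesis using comp by (simp add: triangles_def)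
  qed
  \<comment> \<open>Needed because \<open>card\<close> of an infinite set would be 0. A triangle is
    determined by its vertex and arc sets, which are subsets of those of \<open>G\<close>.\<close>
  have finT: "finite (triangles G)"
  proof (rule finite_subset)
    show "triangles G \<subseteq> (\<lambda>(P, Q). \<lparr>pverts = P, parcs = Q\<rparr>) ` (Pow (pverts G) \<times> Pow (parcs G))"
    proof
      fix T assume "T \<in> triangles G"
      then have "pverts T \<subseteq> pverts G" "parcs T \<subseteq> parcs G"
        unfolding triangles_def subgraph_def by auto
      then show "T \<in> (\<lambda>(P, Q). \<lparr>pverts = P, parcs = Q\<rparr>) ` (Pow (pverts G) \<times> Pow (parcs G))"
        by (intro image_eqI[of _ _ "(pverts T, parcs T)"]) auto
    qed
    show "finite ((\<lambda>(P, Q). \<lparr>pverts = P, parcs = Q\<rparr>) ` (Pow (pverts G) \<times> Pow (parcs G)))"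
      using pair_finite_verts pair_finite_arcs by simp
  qed
  have "inj_on K F" unfolding inj_on_def K_def by simp
  then have "card F \<le> card (triangles G)"
    using KT finT by (intro card_inj_on_le[of K]) auto
  moreover have "{(a, b, c). (a, b) \<in> parcs G \<and> (b, c) \<in> parcs G \<and> (a, c) \<in> parcs G}
      \<subseteq> {(a, b, c). distinct [a, b, c] \<and> {a, b, c} \<in> F}"
    using loop unfolding F_def by fastforce
  then have "card {(a, b, c). (a, b) \<in> parcs G \<and> (b, c) \<in> parcs G \<and> (a, c) \<in> parcs G}
      \<le> card {(a, b, c). distinct [a, b, c] \<and> {a, b, c} \<in> F}"
  proof (rule card_mono[rotated])
    show "finite {(a, b, c). distinct [a, b, c] \<and> {a, b, c} \<in> F}"
      by (rule finite_subset[of _ "pverts G \<times> pverts G \<times> pverts G"])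
        (use \<open>F \<subseteq> Pow (pverts G)\<close> pair_finite_verts in auto)
  qed
  ultimately show ?thesis using card_ordered_triples_le[OF finF card3] by linarith
qed

section \<open>Transfer to regular graphs\<close>

lemma regular_graph_adjacency:
  assumes "regular_graph k G"
  shows "regular_adjacency (pverts G) (\<lambda>u v. (u, v) \<in> parcs G) k"
proof -
  interpret pair_graph G using assms by (simp add: regular_graph_def)
  show ?thesis
  proof
    fix v assume "v \<in> pverts G"
    then have "card (out_arcs (with_proj G) v) = k"
      using assms by (simp add: regular_graph_def out_degree_def)
    moreover have "out_arcs (with_proj G) v = Pair v ` {w. (v, w) \<in> parcs G}"
      by (auto simp: out_arcs_def)
    ultimately show "card {w. (v, w) \<in> parcs G} = k"
      by (simp add: card_image inj_on_def)
  next
    fix u v assume "(u, v) \<in> parcs G"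
    then show "(v, u) \<in> parcs G"
      using pair_sym_arcs unfolding symmetric_def by (auto elim: symE)
  qed (use pair_finite_verts in_arcsD1 pair_no_loops[of "(_, _)"] in auto)
qed

theorem theorem2:
  fixes G :: "'a pair_pre_digraph" and n k :: nat
  assumes "regular_graph k G"
    and "card (pverts G) = n"
    and "odd n"
    and "k > 2 * (n div 5)"
  shows "real (card (triangles G)) \<ge> 1 / 300 * (real n)\<^sup>2"
proof -
  interpret regular_adjacency "pverts G" "\<lambda>u v. (u, v) \<in> parcs G" k
    using regular_graph_adjacency[OF assms(1)] .
  \<comment> \<open>Parity raises the bound on \<open>k\<close> to \<open>2(n div 5) + 2\<close>, so
    that \<open>5k \<ge> 10(n div 5) + 10\<close>, whereas
    \<open>2n \<le> 10(n div 5) + 8\<close>.\<close>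
  have "even k" using handshake assms(2,3) by simp
  then obtain j where "k = 2 * j" by (rule evenE)
  then have "n div 5 + 1 \<le> j" using assms(4) by linarith
  then have "2 * n < 5 * k" using \<open>k = 2 * j\<close> by linarith
  then have "n\<^sup>2 \<le> 50 * card ordered_triangles"
    using many_ordered_triangles assms(2,3) by simp
  also have "card ordered_triangles \<le> 6 * card (triangles G)"
    unfolding ordered_triangles_def
    using card_ordered_triangles_le assms(1) by (auto simp: regular_graph_def)
  finally have "n\<^sup>2 \<le> 300 * card (triangles G)" by simp
  then have "real (n\<^sup>2) \<le> real (300 * card (triangles G))" by (simp only: of_nat_le_iff)
  then show ?thesis by simp
qed

end
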